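(* Let $F_1,F_2\colon\mathbb{R}^n\rightrightarrows\mathbb{R}^p$ be set-valued mappings with convex graphs such that $$\mathrm{ri}(\mathrm{gph}(F_1))\cap\mathrm{ri}(\mathrm{gph}(F_2))\neq\emptyset.$$ Then for any $\bar{x}\in\mathbb{R}^n$, $\bar{y}\in(F_1\cap F_2)(\bar{x})$ and $v\in\mathbb{R}^p$ we have $$D^*(F_1\cap F_2)(\bar{x},\bar{y})(v)=\bigcup_{v_1+v_2=v}\big[D^*F_1(\bar{x},\bar{y})(v_1)+D^*F_2(\bar{x},\bar{y})(v_2)\big],$$ where the union is over all $v_1,v_2\in\mathbb{R}^p$ with $v_1+v_2=v$.
   Context: A set-valued mapping $F\colon\mathbb{R}^n\rightrightarrows\mathbb{R}^p$ assigns to each $x$ a set $F(x)\subset\mathbb{R}^p$ (possibly empty); $\mathrm{gph}(F):=\{(x,y) : y\in F(x)\}$. $(F_1\cap F_2)(x):=F_1(x)\cap F_2(x)$. For a convex set $\Omega$ and $\bar{x}\in\Omega$, the normal cone is $N(\bar{x};\Omega):=\{v : \langle v,x-\bar{x}\rangle\le 0\text{ for all }x\in\Omega\}$. The coderivative of $F$ at $(\bar{x},\bar{y})\in\mathrm{gph}(F)$ is $D^*F(\bar{x},\bar{y})(v):=\{u\in\mathbb{R}^n : (u,-v)\in N((\bar{x},\bar{y});\mathrm{gph}(F))\}$, $v\in\mathbb{R}^p$. The relative interior $\mathrm{ri}(\Omega)$ of a convex set $\Omega$ is the set of $x\in\Omega$ for which there is $\gamma>0$ with $\mathbb{B}(x;\gamma)\cap\mathrm{aff}(\Omega)\subset\Omega$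 (closed ball, affine hull). Sums of sets are Minkowski sums. *)

theory Defs
  imports "HOL-Analysis.Analysis"
begin

definition gph :: "('a \<Rightarrow> 'b set) \<Rightarrow> ('a \<times> 'b) set" where
  "gph F = {(x, y). y \<in> F x}"

text \<open>The normal cone is meant for convex \<open>\<Omega>\<close> and \<open>x0 \<in> \<Omega>\<close>, and the coderivative for
  \<open>y0 \<in> F x0\<close>; the values outside these domains carry no meaning.\<close>

definition normal_cone :: "'a::real_inner \<Rightarrow> 'a set \<Rightarrow> 'a set" where
  "normal_cone x0 \<Omega> = {v. \<forall>x\<in>\<Omega>. v \<bullet> (x - x0) \<le> 0}"

definition coderivative ::
  "('a::real_inner \<Rightarrow> 'b::real_inner set) \<Rightarrow> 'a \<Rightarrow> 'b \<Rightarrow> 'b \<Rightarrow> 'a set" where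
  "coderivative F x0 y0 v = {u. (u, - v) \<in> normal_cone (x0, y0) (gph F)}"

end

theory Submission
  imports Defs
begin

text \<open>
  Since \<open>gph (F1 \<inter> F2) = gph F1 \<inter> gph F2\<close>, the coderivative formula is the normal cone
  formula \<open>N(x; A \<inter> B) = N(x; A) + N(x; B)\<close> read off in coordinates \<open>(u, - v)\<close>. In that
  formula only \<open>\<subseteq>\<close> has content: a functional \<open>w\<close> that attains its maximum over
  \<open>A \<inter> B\<close> at \<open>x\<close> has to be split as \<open>(w - p) + p\<close>, with \<open>w - p\<close> normal to \<open>A\<close> and \<open>p\<close> normal
  to \<open>B\<close>.

  The vector \<open>p\<close> is a Lagrange multiplier for the problem of maximizing \<open>w \<bullet> (a - x)\<close> over
  \<open>a \<in> A\<close>, \<open>b \<in> B\<close> subject to the constraint \<open>a - b = 0\<close>: an inequality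
  \<open>w \<bullet> (a - x) \<le> p \<bullet> (a - b)\<close> valid on all of \<open>A \<times> B\<close> yields both normality conditions upon
  setting \<open>b = x\<close> or \<open>a = x\<close>. Such a \<open>p\<close> is found by separating the origin from the strict
  hypograph of the value function of this problem. The common relative interior point
  plays the part of Slater's condition: it excludes a vertical separating
  hyperplane (\<open>normal_cone_Int_multiplier\<close>).
\<close>

text \<open>A linear functional cannot be minimal at a relative interior point without being
  constant, since every segment ending at that point can be prolonged inside the set.\<close>

lemma inner_constant_if_minimal_on_rel_interior:
  fixes S :: "'a::euclidean_space set"
  assumes "convex S" and z: "z \<in> rel_interior S"
    and min: "\<And>s. s \<in> S \<Longrightarrow> p \<bullet> z \<le> p \<bullet> s"
    and s: "s \<in> S"
  shows "p \<bullet> s = p \<bullet> z"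
proof -
  obtain e where e: "e > 1" "(1 - e) *\<^sub>R s + e *\<^sub>R z \<in> S"
    using convex_rel_interior_iff[OF \<open>convex S\<close>, of z] z s by blast
  have "p \<bullet> z \<le> (1 - e) * (p \<bullet> s) + e * (p \<bullet> z)"
    using min[OF e(2)] by (simp add: inner_add_right)
  then have "(e - 1) * (p \<bullet> s) \<le> (e - 1) * (p \<bullet> z)"
    by (simp add: algebra_simps)
  then have "p \<bullet> s \<le> p \<bullet> z"
    using e(1) by simp
  then show ?thesis
    using min[OF s] by simp
qed

text \<open>The separating functional \<open>(q, \<alpha>)\<close> is chosen in the span of the hypograph. This choice
  is what makes a vertical hyperplane impossible: if \<open>\<alpha> = 0\<close>, then \<open>q\<close> separates \<open>A\<close> from \<open>B\<close>
  and is therefore constant on both, with the same value, because they share a relative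
  interior point; so \<open>q\<close> is orthogonal to all differences \<open>a - b\<close>, yet lies in their span.\<close>

lemma normal_cone_Int_multiplier:
  fixes A B :: "'a::euclidean_space set"
  assumes "convex A" "convex B"
    and zA: "z \<in> rel_interior A" and zB: "z \<in> rel_interior B"
    and w: "w \<in> normal_cone x (A \<inter> B)"
  obtains p where "\<And>a b. a \<in> A \<Longrightarrow> b \<in> B \<Longrightarrow> w \<bullet> (a - x) \<le> p \<bullet> (a - b)"
proof -
  have zAB: "z \<in> A" "z \<in> B"
    using zA zB rel_interior_subset by blast+
  define D where "D = {a - b | a b. a \<in> A \<and> b \<in> B}"
  define H where "H = {(a - b, w \<bullet> (a - x) - r) | a b r. a \<in> A \<and> b \<in> B \<and> r > (0::real)}"
  have "convex H"
  proof (rule convexI)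
    fix h k and s t :: real
    assume "h \<in> H" "k \<in> H" and st: "0 \<le> s" "0 \<le> t" "s + t = 1"
    then obtain a b r a' b' r' where
      h: "h = (a - b, w \<bullet> (a - x) - r)" "a \<in> A" "b \<in> B" "r > 0" and
      k: "k = (a' - b', w \<bullet> (a' - x) - r')" "a' \<in> A" "b' \<in> B" "r' > 0"
      unfolding H_def by blast
    let ?a = "s *\<^sub>R a + t *\<^sub>R a'" and ?b = "s *\<^sub>R b + t *\<^sub>R b'" and ?r = "s * r + t * r'"
    have "?a \<in> A" "?b \<in> B"
      using h k st assms(1,2) by (auto intro: convexD)
    moreover have "?r > 0"
      using h k st convexD[of "{0<..}" r r' s t] by (simp add: convex_real_interval)
    moreover have "s *\<^sub>R h + t *\<^sub>R k = (?a - ?b, w \<bullet> (?a - x) - ?r)"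
    proof -
      have "w \<bullet> x = s * (w \<bullet> x) + t * (w \<bullet> x)"
        using st(3) by (metis distrib_right mult_1)
      then show ?thesis
        unfolding h k by (simp add: algebra_simps inner_simps)
    qed
    ultimately show "s *\<^sub>R h + t *\<^sub>R k \<in> H"
      unfolding H_def by blast
  qed
  moreover have "H \<noteq> {}"
    using zAB zero_less_one unfolding H_def by blast
  moreover have "0 \<notin> H"
    using w unfolding H_def normal_cone_def by (force simp: zero_prod_def)
  ultimately obtain c where c: "c \<in> span H" "c \<noteq> 0" "\<And>h. h \<in> H \<Longrightarrow> 0 \<le> c \<bullet> h"
    using separating_hyperplane_set_0_inspan[of H] by blast
  obtain q \<alpha> where q\<alpha>: "c = (q, \<alpha>)"
    by fastforce
  have sep: "\<alpha> * r \<le> q \<bullet> (a - b) + \<alpha> * (w \<bullet> (a - x))" if "a \<in> A" "b \<in> B" "r > 0" for a b r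
  proof -
    have "(a - b, w \<bullet> (a - x) - r) \<in> H"
      using that unfolding H_def by blast
    from c(3)[OF this] show ?thesis
      by (simp add: q\<alpha> algebra_simps)
  qed
  \<comment> \<open>\<open>H\<close> is unbounded downwards in its last coordinate, which forces the sign of \<open>\<alpha>\<close>.\<close>
  have "\<alpha> \<le> 0"
  proof (rule ccontr)
    assume "\<not> \<alpha> \<le> 0"
    define K where "K = \<alpha> * (w \<bullet> (z - x))"
    have "\<alpha> * ((\<bar>K\<bar> + 1) / \<alpha>) \<le> K"
      using sep[OF zAB, of "(\<bar>K\<bar> + 1) / \<alpha>"] \<open>\<not> \<alpha> \<le> 0\<close> by (simp add: K_def)
    then show False
      using \<open>\<not> \<alpha> \<le> 0\<close> by simp
  qed
  moreover have "\<alpha> \<noteq> 0"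
  proof
    assume "\<alpha> = 0"
    then have qsep: "q \<bullet> b \<le> q \<bullet> a" if "a \<in> A" "b \<in> B" for a b
      using sep[OF that zero_less_one] by (simp add: inner_diff_right)
    have "q \<bullet> a = q \<bullet> z" if "a \<in> A" for a
      using inner_constant_if_minimal_on_rel_interior[OF \<open>convex A\<close> zA _ that, of q] qsep zAB
      by blast
    moreover have "q \<bullet> b = q \<bullet> z" if "b \<in> B" for b
      using inner_constant_if_minimal_on_rel_interior[OF \<open>convex B\<close> zB _ that, of "- q"] qsep zAB
      by simp
    ultimately have "orthogonal q d" if "d \<in> D" for d
      using that by (auto simp: D_def orthogonal_def inner_diff_right)
    moreover have "q \<in> span D"
    proof -
      have "fst ` H \<subseteq> D"
        unfolding H_def D_def by auto blast
      moreover have "q \<in> span (fst ` H)"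
        using c(1) linear_span_image[OF linear_fst, of H] by (force simp: q\<alpha>)
      ultimately show ?thesis
        using span_mono by blast
    qed
    ultimately have "orthogonal q q"
      using orthogonal_to_span by blast
    then show False
      using c(2) \<open>\<alpha> = 0\<close> by (simp add: q\<alpha> orthogonal_def zero_prod_def)
  qed
  ultimately have \<alpha>: "\<alpha> < 0"
    by simp
  \<comment> \<open>Dividing by \<open>\<alpha>\<close> gives slope \<open>- q / \<alpha>\<close>; the strictness \<open>r > 0\<close> disappears in the limit.\<close>
  show thesis
  proof (rule that[of "(- 1 / \<alpha>) *\<^sub>R q"])
    fix a b assume ab: "a \<in> A" "b \<in> B"
    show "w \<bullet> (a - x) \<le> ((- 1 / \<alpha>) *\<^sub>R q) \<bullet> (a - b)"
    proof (rule field_le_epsilon)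
      fix r :: real assume "r > 0"
      show "w \<bullet> (a - x) \<le> ((- 1 / \<alpha>) *\<^sub>R q) \<bullet> (a - b) + r"
        using sep[OF ab \<open>r > 0\<close>] \<alpha> by (simp add: field_simps)
    qed
  qed
qed

theorem normal_cone_Int:
  fixes A B :: "'a::euclidean_space set"
  assumes "convex A" "convex B"
    and ri: "rel_interior A \<inter> rel_interior B \<noteq> {}"
    and x: "x \<in> A \<inter> B"
  shows "normal_cone x (A \<inter> B) = normal_cone x A + normal_cone x B"
proof (intro equalityI subsetI)
  fix w assume w: "w \<in> normal_cone x (A \<inter> B)"
  from ri obtain z where "z \<in> rel_interior A" "z \<in> rel_interior B"
    by blast
  from normal_cone_Int_multiplier[OF assms(1,2) this w]
  obtain p where p: "\<And>a b. a \<in> A \<Longrightarrow> b \<in> B \<Longrightarrow> w \<bullet> (a - x) \<le> p \<bullet> (a - b)"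
    by blast
  have "w - p \<in> normal_cone x A"
    using p[of _ x] x by (auto simp: normal_cone_def inner_diff_left)
  moreover have "p \<in> normal_cone x B"
    using p[of x] x by (auto simp: normal_cone_def inner_diff_right)
  ultimately have "(w - p) + p \<in> normal_cone x A + normal_cone x B"
    by (rule set_plus_intro)
  then show "w \<in> normal_cone x A + normal_cone x B"
    by simp
next
  fix w assume "w \<in> normal_cone x A + normal_cone x B"
  then show "w \<in> normal_cone x (A \<inter> B)"
    by (force elim!: set_plus_elim simp: normal_cone_def inner_add_left intro: add_nonpos_nonpos)
qed

lemma gph_Int: "gph (\<lambda>x. F x \<inter> G x) = gph F \<inter> gph G"
  by (auto simp: gph_def)

theorem proposition11p3:
  fixes F1 F2 :: "real ^ 'n \<Rightarrow> (real ^ 'p) set"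
    and xbar :: "real ^ 'n" and ybar v :: "real ^ 'p"
  assumes "convex (gph F1)"
    and "convex (gph F2)"
    and "rel_interior (gph F1) \<inter> rel_interior (gph F2) \<noteq> {}"
    and "ybar \<in> F1 xbar \<inter> F2 xbar"
  shows "coderivative (\<lambda>x. F1 x \<inter> F2 x) xbar ybar v =
    (\<Union>(v1, v2) \<in> {(v1, v2). v1 + v2 = v}.
      coderivative F1 xbar ybar v1 + coderivative F2 xbar ybar v2)"
proof -
  let ?N1 = "normal_cone (xbar, ybar) (gph F1)" and ?N2 = "normal_cone (xbar, ybar) (gph F2)"
  have "(xbar, ybar) \<in> gph F1 \<inter> gph F2"
    using assms(4) by (simp add: gph_def)
  then have N: "normal_cone (xbar, ybar) (gph (\<lambda>x. F1 x \<inter> F2 x)) = ?N1 + ?N2"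
    unfolding gph_Int using normal_cone_Int assms(1-3) by blast
  show ?thesis
  proof (intro equalityI subsetI)
    fix u assume "u \<in> coderivative (\<lambda>x. F1 x \<inter> F2 x) xbar ybar v"
    then have "(u, - v) \<in> ?N1 + ?N2"
      by (simp add: coderivative_def N)
    then obtain u1 y1 u2 y2 where
      n: "(u1, y1) \<in> ?N1" "(u2, y2) \<in> ?N2" and uv: "u = u1 + u2" "- v = y1 + y2"
      by (auto elim!: set_plus_elim)
    have "u1 + u2 \<in> coderivative F1 xbar ybar (- y1) + coderivative F2 xbar ybar (- y2)"
      using n by (intro set_plus_intro) (simp_all add: coderivative_def)
    moreover have "- y1 + - y2 = v"
      using uv(2) by (metis minus_add_distrib minus_minus)
    ultimately show "u \<in> (\<Union>(v1, v2) \<in> {(v1, v2). v1 + v2 = v}.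
        coderivative F1 xbar ybar v1 + coderivative F2 xbar ybar v2)"
      using uv(1) by blast
  next
    fix u assume "u \<in> (\<Union>(v1, v2) \<in> {(v1, v2). v1 + v2 = v}.
        coderivative F1 xbar ybar v1 + coderivative F2 xbar ybar v2)"
    then obtain v1 v2 u1 u2 where
      n: "(u1, - v1) \<in> ?N1" "(u2, - v2) \<in> ?N2" and uv: "u = u1 + u2" "v = v1 + v2"
      by (auto elim!: set_plus_elim simp: coderivative_def)
    have "(u, - v) = (u1, - v1) + (u2, - v2)"
      by (simp add: uv)
    then have "(u, - v) \<in> ?N1 + ?N2"
      using n by (metis set_plus_intro)
    then show "u \<in> coderivative (\<lambda>x. F1 x \<inter> F2 x) xbar ybar v"
      by (simp add: coderivative_def N)
  qed
qed

end
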